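(* Let $q=p^m$ for some prime $p$ and integer $m\ge1$, and let $\lambda$ be a positive integer such that $\ell\equiv\pm1\pmod q$ for every prime divisor $\ell$ of $\lambda$. If the finite (not necessarily abelian) group $G$ has the additive abelian group $(\mathbb{Z}_p)^m$ as a quotient group, then for any $\lambda$-fold near-factorization $(S,T)$ of $G$, we have: \begin{itemize} \item $|S|^{p-1}\equiv|T|^{p-1}\equiv1\pmod{p^m}$, if $p$ is an odd prime; \item $|S|\equiv-|T|\equiv\pm1\pmod{2^m}$, if $p=2$ and $\lambda^{q-1}\equiv1\pmod q$; \item $|S|\equiv|T|\equiv\pm1\pmod{2^m}$, if $p=2$ and $\lambda^{q-1}\equiv-1\pmod q$. \end{itemize}
   Context: For subsets $S,T$ of a finite group $G$ with identity $e$, and a positive integer $\lambda$, $(S,T)$ is a $\lambda$-fold near-factorization of $G$ if every non-identity element $g\in G$ can be written as $g=xy$ with $x\in S$, $y\in T$ in exactly $\lambda$ ways, and $xy\neq e$ for all $x\in S$, $y\in T$ (equivalently $ST=\lambda(G-e)$ in the group ring $\mathbb{Z}[G]$). The notation $a\equiv\pm1\pmod q$ means $a\equiv1$ or $a\equiv-1\pmod q$; the sign may differ for different prime divisors $\ell$. $\mathbb{Z}_p$ is the cyclic group of order $p$. *)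

theory Defs
  imports
    "HOL-Algebra.Algebra"
    "HOL-Number_Theory.Number_Theory"
begin

definition near_factorization ::
    "('a, 'b) monoid_scheme \<Rightarrow> nat \<Rightarrow> 'a set \<Rightarrow> 'a set \<Rightarrow> bool" where
  "near_factorization G lam S T \<longleftrightarrow>
     S \<subseteq> carrier G \<and> T \<subseteq> carrier G \<and>
     (\<forall>g \<in> carrier G - {\<one>\<^bsub>G\<^esub>}. card {(x, y). x \<in> S \<and> y \<in> T \<and> x \<otimes>\<^bsub>G\<^esub> y = g} = lam) \<and>
     (\<forall>x \<in> S. \<forall>y \<in> T. x \<otimes>\<^bsub>G\<^esub> y \<noteq> \<one>\<^bsub>G\<^esub>)"

definition elementary_abelian :: "nat \<Rightarrow> nat \<Rightarrow> (nat \<Rightarrow> int) monoid" where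
  "elementary_abelian p m = product_group {..<m} (\<lambda>_. integer_mod_group p)"

definition cong_pm1 :: "int \<Rightarrow> int \<Rightarrow> bool" where
  "cong_pm1 a q \<longleftrightarrow> [a = 1] (mod q) \<or> [a = - 1] (mod q)"

end

theory Submission
  imports Defs
begin

text \<open>
  Push \<open>S\<close> and \<open>T\<close> forward to \<open>V = (\<int>/p)\<^sup>m\<close>. Every nontrivial character \<open>\<chi>\<close> of \<open>V\<close>
  satisfies \<open>\<chi>(S) \<chi>(T) = -\<lambda>\<close>, so the norm \<open>n(\<chi>) = \<Prod>k=1..p-1. \<chi>\<^sup>k(S)\<close> is an integer dividing
  \<open>\<lambda>\<^sup>p\<^sup>-\<^sup>1\<close>, whence \<open>n(\<chi>) \<equiv> \<plusminus>1\<close> modulo \<open>q\<close>; moreover \<open>n(\<chi>) \<equiv> |S|\<^sup>p\<^sup>-\<^sup>1\<close> modulo \<open>p\<close>. For odd \<open>p\<close> this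
  and Fermat's theorem force \<open>n(\<chi>) \<equiv> 1\<close> modulo \<open>q\<close>. By Fourier inversion the sum of the norms over
  all characters, where the trivial one contributes \<open>|S|\<^sup>p\<^sup>-\<^sup>1\<close>, is divisible by \<open>q\<close>, and therefore
  \<open>|S|\<^sup>p\<^sup>-\<^sup>1 \<equiv> 1\<close>. For \<open>p = 2\<close> one has \<open>\<chi>(S)\<^sup>2 \<equiv> 1\<close> modulo \<open>2q\<close> for nontrivial \<open>\<chi>\<close>, and Parseval's
  identity gives \<open>|S|\<^sup>2 \<equiv> 1\<close> modulo \<open>2q\<close>, hence \<open>|S| \<equiv> \<plusminus>1\<close> modulo \<open>q\<close>; the relation to \<open>|T|\<close> follows
  from \<open>|S| |T| = \<lambda> (|G| - 1)\<close>.
\<close>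

subsection \<open>Additive characters modulo p\<close>

definition e_char :: "nat \<Rightarrow> int \<Rightarrow> complex" where
  "e_char p k = cis (2 * pi * of_int k / of_nat p)"

lemma e_char_0 [simp]: "e_char p 0 = 1"
  by (simp add: e_char_def)

lemma e_char_add: "e_char p (a + b) = e_char p a * e_char p b"
  by (simp add: e_char_def cis_mult distrib_left add_divide_distrib)

lemma e_char_sum: "e_char p (sum f A) = (\<Prod>i\<in>A. e_char p (f i))"
  by (induction A rule: infinite_finite_induct) (auto simp: e_char_add)

lemma e_char_power: "e_char p (int n * a) = e_char p a ^ n"
  by (induction n) (auto simp: e_char_add distrib_right)

lemma e_char_eq_1_iff:
  assumes "p > 0"
  shows "e_char p k = 1 \<longleftrightarrow> int p dvd k"
proof
  assume "e_char p k = 1"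
  hence "cos (2 * pi * of_int k / of_nat p) = 1"
    by (simp add: e_char_def complex_eq_iff)
  then obtain n :: int where "2 * pi * of_int k / of_nat p = of_int n * 2 * pi"
    by (auto simp: cos_one_2pi_int)
  hence "(of_int k :: real) = of_int (n * int p)"
    using assms by (simp add: field_simps)
  hence "k = n * int p" by (simp only: of_int_eq_iff)
  thus "int p dvd k" by simp
next
  assume "int p dvd k"
  then obtain n where "k = int p * n" by blast
  hence "2 * pi * of_int k / of_nat p = 2 * pi * of_int n"
    using assms by simp
  thus "e_char p k = 1"
    by (simp add: e_char_def)
qed

lemma e_char_cong:
  assumes "p > 0" "[a = b] (mod int p)"
  shows "e_char p a = e_char p b"
proof -
  have "e_char p (a - b) = 1"
    using assms by (simp add: e_char_eq_1_iff cong_iff_dvd_diff)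
  thus ?thesis
    using e_char_add[of p "a - b" b] by simp
qed

lemma e_char_mod [simp]: "p > 0 \<Longrightarrow> e_char p (a mod int p) = e_char p a"
  by (rule e_char_cong) (auto simp: cong_def)

lemma e_char_power_eq_1 [simp]: "p > 0 \<Longrightarrow> e_char p a ^ p = 1"
  by (simp add: e_char_eq_1_iff flip: e_char_power)

text \<open>Orthogonality on Z/p: a geometric sum whose ratio \<open>e_char p a\<close> is a p-th
  root of unity, equal to 1 exactly when \<open>p\<close> divides \<open>a\<close>.\<close>

lemma sum_e_char:
  assumes "p > 0"
  shows "(\<Sum>j<p. e_char p (int j * a)) = (if int p dvd a then of_nat p else 0)"
proof (cases "int p dvd a")
  case True
  hence "e_char p a = 1" using assms by (simp add: e_char_eq_1_iff)
  thus ?thesis using True by (simp add: e_char_power)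
next
  case False
  hence "e_char p a \<noteq> 1" using assms by (simp add: e_char_eq_1_iff)
  hence "(\<Sum>j<p. e_char p a ^ j) = 0"
    using assms by (simp add: sum_gp_strict)
  thus ?thesis using False by (simp add: e_char_power)
qed

section \<open>The dual group of (Z/p)^m\<close>

abbreviation dot :: "nat \<Rightarrow> (nat \<Rightarrow> nat) \<Rightarrow> (nat \<Rightarrow> int) \<Rightarrow> int" where
  "dot m u v \<equiv> (\<Sum>i<m. int (u i) * v i)"

text \<open>Each \<open>u\<close> stands for the character sending \<open>v\<close> to
  \<open>e_char p (dot m u v)\<close>. Extensional functions into \<open>{..<p}\<close> list every
  character exactly once.\<close>

abbreviation dual :: "nat \<Rightarrow> nat \<Rightarrow> (nat \<Rightarrow> nat) set" where
  "dual p m \<equiv> {..<m} \<rightarrow>\<^sub>E {..<p}"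

text \<open>The sum over \<open>u\<close> factors into one geometric sum per coordinate.\<close>

lemma sum_dual_e_char:
  assumes "p > 0"
  shows "(\<Sum>u\<in>dual p m. e_char p (dot m u v)) = (if \<forall>i<m. int p dvd v i then of_nat (p ^ m) else 0)"
proof -
  have "(\<Sum>u\<in>dual p m. e_char p (dot m u v)) = (\<Prod>i<m. \<Sum>j<p. e_char p (int j * v i))"
    by (simp add: e_char_sum prod_sum_PiE)
  also have "\<dots> = (\<Prod>i<m. if int p dvd v i then of_nat p else 0)"
    using assms by (simp add: sum_e_char)
  also have "\<dots> = (if \<forall>i<m. int p dvd v i then of_nat (p ^ m) else 0)"
    by (auto intro: prod_zero)
  finally show ?thesis .
qed

section \<open>Norms of cyclotomic integers\<close>

lemma sum_e_char_fibres:
  assumes "p > 0" "finite P"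
  shows "(\<Sum>y\<in>P. e_char p (W y)) =
    (\<Sum>j<p. of_nat (card {y\<in>P. W y mod int p = int j}) * e_char p (int j))"
proof -
  have "(\<Sum>y\<in>P. e_char p (W y)) =
      (\<Sum>j<p. \<Sum>y\<in>{y\<in>P. nat (W y mod int p) = j}. e_char p (W y))"
    using assms by (intro sum.group[symmetric]) (auto simp: nat_less_iff)
  also have "\<dots> = (\<Sum>j<p. \<Sum>y\<in>{y\<in>P. W y mod int p = int j}. e_char p (int j))"
  proof (intro sum.cong refl)
    fix j
    show "{y\<in>P. nat (W y mod int p) = j} = {y\<in>P. W y mod int p = int j}"
      using assms by auto
  next
    fix j y assume "y \<in> {y\<in>P. W y mod int p = int j}"
    thus "e_char p (W y) = e_char p (int j)"
      using e_char_mod[OF assms(1), of "W y"] by simp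
  qed
  finally show ?thesis by simp
qed

text \<open>Reindexing a tuple by multiplication with \<open>a\<close> modulo \<open>p\<close> divides its weighted sum by \<open>a\<close>.\<close>

lemma card_weighted_sum_fibre_le:
  fixes f :: "'a \<Rightarrow> int" and a i j p :: nat
  assumes p: "Factorial_Ring.prime p" and "finite S" and a: "a \<in> {1..<p}"
    and j: "[a * i = j] (mod p)" and "i < p" "j < p"
  defines "W \<equiv> \<lambda>y. \<Sum>k\<in>{1..<p}. int k * f (y k)"
  shows "card {y \<in> {1..<p} \<rightarrow>\<^sub>E S. W y mod int p = int j} \<le>
         card {y \<in> {1..<p} \<rightarrow>\<^sub>E S. W y mod int p = int i}"
proof (rule card_inj_on_le)
  define \<pi> where "\<pi> = (\<lambda>k. a * k mod p)"
  have "\<not> p dvd a" using a by (auto dest: dvd_imp_le)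
  hence cop: "coprime a p"
    using p by (metis coprime_commute prime_imp_coprime)
  have bij: "bij_betw \<pi> {1..<p} {1..<p}"
  proof -
    have "inj_on \<pi> {1..<p}"
    proof (rule inj_onI)
      fix k l assume kl: "k \<in> {1..<p}" "l \<in> {1..<p}" and "\<pi> k = \<pi> l"
      hence "[a * k = a * l] (mod p)" by (simp add: \<pi>_def cong_def)
      hence "[k = l] (mod p)" using cop by (simp add: cong_mult_lcancel_nat)
      with kl show "k = l" by (simp add: cong_def)
    qed
    moreover have "\<pi> ` {1..<p} \<subseteq> {1..<p}"
    proof safe
      fix k assume "k \<in> {1..<p}"
      hence "\<not> p dvd k" by (auto dest: dvd_imp_le)
      hence "\<not> p dvd a * k" using \<open>\<not> p dvd a\<close> p by (simp add: prime_dvd_mult_iff)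
      thus "\<pi> k \<in> {1..<p}" using prime_gt_0_nat[OF p] by (auto simp: \<pi>_def mod_greater_zero_iff_not_dvd Suc_le_eq)
    qed
    ultimately show ?thesis by (simp add: bij_betw_def endo_inj_surj)
  qed
  let ?F = "\<lambda>y. restrict (\<lambda>k. y (\<pi> k)) {1..<p}"
  show "inj_on ?F {y \<in> {1..<p} \<rightarrow>\<^sub>E S. W y mod int p = int j}"
  proof (rule inj_onI)
    fix y z
    assume y: "y \<in> {y \<in> {1..<p} \<rightarrow>\<^sub>E S. W y mod int p = int j}"
      and z: "z \<in> {y \<in> {1..<p} \<rightarrow>\<^sub>E S. W y mod int p = int j}" and eq: "?F y = ?F z"
    have "y k = z k" if "k \<in> {1..<p}" for k
    proof -
      obtain l where l: "l \<in> {1..<p}" "k = \<pi> l"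
        using \<open>k \<in> {1..<p}\<close> bij by (metis bij_betw_imp_surj_on imageE)
      with fun_cong[OF eq, of l] show ?thesis by simp
    qed
    with y z show "y = z" by (intro PiE_ext[of y "{1..<p}" "\<lambda>_. S" z]) auto
  qed
  show "?F ` {y \<in> {1..<p} \<rightarrow>\<^sub>E S. W y mod int p = int j}
      \<subseteq> {y \<in> {1..<p} \<rightarrow>\<^sub>E S. W y mod int p = int i}"
  proof (rule image_subsetI)
    fix y
    assume "y \<in> {y \<in> {1..<p} \<rightarrow>\<^sub>E S. W y mod int p = int j}"
    hence y: "y \<in> {1..<p} \<rightarrow>\<^sub>E S" and W: "W y mod int p = int j" by auto
    have in_range: "\<pi> k \<in> {1..<p}" if "k \<in> {1..<p}" for k
      using bij that by (rule bij_betw_apply)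
    have F: "?F y \<in> {1..<p} \<rightarrow>\<^sub>E S"
      using y in_range by (auto simp: PiE_iff)
    \<comment> \<open>Multiplication by \<open>a\<close> turns each weight \<open>k\<close> into
      \<open>\<pi> k\<close> modulo \<open>p\<close>; as \<open>\<pi>\<close> permutes the weights,
      the result is \<open>W y\<close>.\<close>
    have "[int a * W (?F y) = (\<Sum>k\<in>{1..<p}. int (\<pi> k) * f (y (\<pi> k)))] (mod int p)"
      unfolding W_def sum_distrib_left
    proof (rule cong_sum)
      fix k assume "k \<in> {1..<p}"
      hence "int a * (int k * f (?F y k)) = int (a * k) * f (y (\<pi> k))" by simp
      moreover have "[int (a * k) = int (\<pi> k)] (mod int p)"
        by (simp add: \<pi>_def cong_def zmod_int)
      ultimately show "[int a * (int k * f (?F y k)) = int (\<pi> k) * f (y (\<pi> k))] (mod int p)"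
        by (metis cong_scalar_right)
    qed
    also have "(\<Sum>k\<in>{1..<p}. int (\<pi> k) * f (y (\<pi> k))) = W y"
      unfolding W_def by (rule sum.reindex_bij_betw[OF bij])
    also have "[W y = int j] (mod int p)"
      using W \<open>j < p\<close> by (simp add: cong_def)
    also have "[int j = int a * int i] (mod int p)"
      using j by (metis cong_int_iff cong_sym of_nat_mult)
    finally have "[int a * W (?F y) = int a * int i] (mod int p)" .
    hence "[W (?F y) = int i] (mod int p)"
      using cop by (subst (asm) cong_mult_lcancel) auto
    hence "W (?F y) mod int p = int i"
      using \<open>i < p\<close> by (simp add: cong_def)
    with F show "?F y \<in> {y \<in> {1..<p} \<rightarrow>\<^sub>E S. W y mod int p = int i}" by simp
  qed
  show "finite {y \<in> {1..<p} \<rightarrow>\<^sub>E S. W y mod int p = int i}"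
    using \<open>finite S\<close> by (simp add: finite_PiE)
qed

text \<open>The product is the norm of the cyclotomic integer \<open>\<Sum>x\<in>S. e_char p (f x)\<close>. When it is
  expanded, the nontrivial \<open>p\<close>-th roots of unity occur equally often, and they sum to \<open>-1\<close>.\<close>

lemma cyclotomic_norm:
  fixes f :: "'a \<Rightarrow> int"
  assumes p: "Factorial_Ring.prime p" and "finite S"
  obtains n :: int where "(\<Prod>k\<in>{1..<p}. \<Sum>x\<in>S. e_char p (int k * f x)) = of_int n"
    and "[n = int (card S) ^ (p - 1)] (mod int p)"
proof -
  define W where "W = (\<lambda>y. \<Sum>k\<in>{1..<p}. int k * f (y k))"
  define c where "c = (\<lambda>j::nat. card {y \<in> {1..<p} \<rightarrow>\<^sub>E S. W y mod int p = int j})"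
  have p1: "p > 1" using p by (rule prime_gt_1_nat)
  have le: "c j \<le> c i" if "a \<in> {1..<p}" "[a * i = j] (mod p)" "i < p" "j < p" for a i j
    unfolding c_def W_def using card_weighted_sum_fibre_le[OF p \<open>finite S\<close> that] .
  \<comment> \<open>The multiplier \<open>j\<close> gives one inequality, its inverse modulo
    \<open>p\<close> the other.\<close>
  have c_eq: "c j = c 1" if "j \<in> {1..<p}" for j
  proof (rule antisym)
    show "c j \<le> c 1" using that by (intro le[of j]) auto
    have "\<not> p dvd j" using that by (auto dest: dvd_imp_le)
    hence "coprime j p" using p by (metis coprime_commute prime_imp_coprime)
    then obtain a where "[j * a = Suc 0] (mod p)"
      by (auto dest: cong_solve_coprime_nat)
    hence a: "[a mod p * j = 1] (mod p)"
      by (simp add: cong_def mult.commute mod_mult_right_eq)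
    have "a mod p \<noteq> 0"
    proof
      assume "a mod p = 0"
      with a p1 show False by (simp add: cong_def)
    qed
    hence "a mod p \<in> {1..<p}" using p1 by simp
    with a show "c 1 \<le> c j" using that p1 by (intro le[of "a mod p"]) auto
  qed
  have split: "{..<p} = insert 0 {1..<p}" using p1 by auto
  have fin: "finite ({1..<p} \<rightarrow>\<^sub>E S)" using \<open>finite S\<close> by (simp add: finite_PiE)
  have sum0: "(\<Sum>j\<in>{1..<p}. e_char p (int j)) = -1"
    using sum_e_char[of p 1] p1 by (simp add: split add_eq_0_iff)
  have "(\<Prod>k\<in>{1..<p}. \<Sum>x\<in>S. e_char p (int k * f x)) = (\<Sum>y\<in>{1..<p} \<rightarrow>\<^sub>E S. e_char p (W y))"
    using \<open>finite S\<close> by (simp add: prod_sum_PiE W_def e_char_sum)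
  also have "\<dots> = (\<Sum>j<p. of_nat (c j) * e_char p (int j))"
    unfolding c_def using p1 fin by (intro sum_e_char_fibres) auto
  also have "\<dots> = of_nat (c 0) + (\<Sum>j\<in>{1..<p}. of_nat (c j) * e_char p (int j))"
    by (simp add: split)
  also have "(\<Sum>j\<in>{1..<p}. of_nat (c j) * e_char p (int j)) = of_nat (c 1) * (\<Sum>j\<in>{1..<p}. e_char p (int j))"
    unfolding sum_distrib_left
    by (intro sum.cong refl arg_cong2[where f = "(*)"] arg_cong[where f = of_nat] c_eq)
  also note sum0
  finally have 1: "(\<Prod>k\<in>{1..<p}. \<Sum>x\<in>S. e_char p (int k * f x)) = of_int (int (c 0) - int (c 1))"
    by simp
  \<comment> \<open>Counting all tuples gives \<open>c 0 + (p - 1) * c 1\<close>, which differs from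
    the norm \<open>c 0 - c 1\<close> by a multiple of \<open>p\<close>.\<close>
  have "card ({1..<p} \<rightarrow>\<^sub>E S) = (\<Sum>j<p. c j)"
  proof -
    have "card ({1..<p} \<rightarrow>\<^sub>E S) = (\<Sum>j<p. card {y \<in> {1..<p} \<rightarrow>\<^sub>E S. nat (W y mod int p) = j})"
      using sum.group[of "{1..<p} \<rightarrow>\<^sub>E S" "{..<p}" "\<lambda>y. nat (W y mod int p)" "\<lambda>_. 1::nat"] fin p1
      by (simp add: image_subset_iff nat_less_iff)
    also have "\<dots> = (\<Sum>j<p. c j)"
      unfolding c_def using p1 by (intro sum.cong refl arg_cong[where f = card]) auto
    finally show ?thesis .
  qed
  also have "\<dots> = c 0 + (\<Sum>j\<in>{1..<p}. c j)"
    by (simp add: split)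
  also have "(\<Sum>j\<in>{1..<p}. c j) = (\<Sum>j\<in>{1..<p}. c 1)"
    by (intro sum.cong refl c_eq)
  also have "\<dots> = (p - 1) * c 1"
    by simp
  finally have "int (card S) ^ (p - 1) = int (c 0) + int (p - 1) * int (c 1)"
    by (simp add: card_PiE flip: of_nat_power of_nat_mult of_nat_add)
  also have "\<dots> = int (c 0) - int (c 1) + int p * int (c 1)"
    using p1 by (simp add: of_nat_diff algebra_simps)
  finally have "[int (c 0) - int (c 1) = int (card S) ^ (p - 1)] (mod int p)"
    by (simp add: cong_def)
  with 1 show ?thesis by (rule that)
qed

text \<open>Off-diagonal terms cancel in pairs.\<close>

lemma cong_sum_symmetric_diagonal:
  fixes f :: "'a \<Rightarrow> 'a \<Rightarrow> int"
  assumes "finite S" "\<And>x y. f x y = f y x"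
  shows "[(\<Sum>x\<in>S. \<Sum>y\<in>S. f x y) = (\<Sum>x\<in>S. f x x)] (mod 2)"
  using assms(1)
proof (induction S rule: finite_induct)
  case empty
  thus ?case by simp
next
  case (insert a S)
  have swap: "(\<Sum>x\<in>S. f x a) = (\<Sum>y\<in>S. f a y)"
    by (intro sum.cong refl assms(2))
  have "(\<Sum>x\<in>insert a S. \<Sum>y\<in>insert a S. f x y) =
      f a a + (\<Sum>x\<in>S. \<Sum>y\<in>S. f x y) + 2 * (\<Sum>y\<in>S. f a y)"
    using insert.hyps swap by (simp add: sum.distrib)
  also have "[\<dots> = f a a + (\<Sum>x\<in>S. f x x)] (mod 2)"
    using insert.IH by (simp add: cong_iff_dvd_diff)
  finally show ?case using insert by simp
qed

subsection \<open>Congruences to plus or minus one\<close>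

lemma cong_pm1_mult:
  assumes "cong_pm1 a q" "cong_pm1 b q"
  shows "cong_pm1 (a * b) q"
proof -
  obtain s t where st: "s \<in> {1, - 1}" "t \<in> {1, - 1}" and "[a = s] (mod q)" "[b = t] (mod q)"
    using assms unfolding cong_pm1_def by blast
  hence "[a * b = s * t] (mod q)" by (intro cong_mult)
  with st show ?thesis by (auto simp: cong_pm1_def)
qed

lemma cong_pm1_of_prime_divisors:
  fixes n q :: nat
  assumes "\<forall>l::nat. Factorial_Ring.prime l \<and> l dvd n \<longrightarrow> cong_pm1 (int l) (int q)" "n > 0"
  shows "cong_pm1 (int n) (int q)"
  using assms
proof (induction n rule: prime_divisors_induct)
  case zero
  thus ?case by simp
next
  case (unit x)
  thus ?case by (simp add: cong_pm1_def)
next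
  case (factor l n)
  hence "cong_pm1 (int n) (int q)" "cong_pm1 (int l) (int q)" by auto
  thus ?case by (simp add: cong_pm1_mult)
qed

lemma cong_pm1_uminus: "cong_pm1 (- a) q \<longleftrightarrow> cong_pm1 a q"
  using cong_minus_minus_iff[of a 1 q] cong_minus_minus_iff[of a "- 1" q]
  by (auto simp: cong_pm1_def)

text \<open>Every prime factor of \<open>d\<close> divides \<open>n\<close>, and the residues
  \<plusminus>1 are closed under products and change of sign. It will be applied to norms dividing a
  power of \<open>lam\<close>.\<close>

lemma cong_pm1_of_dvd_power:
  fixes n q :: nat and d :: int
  assumes "\<forall>l::nat. Factorial_Ring.prime l \<and> l dvd n \<longrightarrow> cong_pm1 (int l) (int q)" "n > 0"
    and "d dvd int n ^ k"
  shows "cong_pm1 d (int q)"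
proof -
  have dvd: "nat \<bar>d\<bar> dvd n ^ k"
    using assms(3) by (simp add: nat_abs_dvd_iff)
  have "cong_pm1 (int (nat \<bar>d\<bar>)) (int q)"
  proof (rule cong_pm1_of_prime_divisors)
    show "\<forall>l. Factorial_Ring.prime l \<and> l dvd nat \<bar>d\<bar> \<longrightarrow> cong_pm1 (int l) (int q)"
      using assms(1) dvd by (meson dvd_trans prime_dvd_power)
    show "nat \<bar>d\<bar> > 0"
      using dvd \<open>n > 0\<close> by (metis dvd_pos_nat zero_less_power)
  qed
  thus ?thesis by (auto simp: abs_if cong_pm1_uminus split: if_splits)
qed

text \<open>One of \<open>a - 1\<close>, \<open>a + 1\<close> is twice an odd number.\<close>

lemma cong_pm1_of_square:
  fixes a :: int
  assumes "[a\<^sup>2 = 1] (mod 2 * 2 ^ m)" and "m \<ge> 1"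
  shows "cong_pm1 a (2 ^ m)"
proof -
  obtain r where r: "m = Suc r" using \<open>m \<ge> 1\<close> by (cases m) auto
  have dvd: "2 * 2 ^ m dvd a\<^sup>2 - 1" using assms(1) by (simp add: cong_iff_dvd_diff)
  hence "even (a\<^sup>2 - 1)" by (meson dvd_trans dvd_triv_left)
  hence "odd a" by simp
  then obtain t where t: "a = 2 * t + 1" by (rule oddE)
  have "a\<^sup>2 - 1 = 4 * (t * (t + 1))" by (simp add: t power2_eq_square algebra_simps)
  with dvd have "4 * 2 ^ r dvd 4 * (t * (t + 1))" by (simp add: r)
  hence "2 ^ r dvd t * (t + 1)" by simp
  \<comment> \<open>Consecutive integers have opposite parity, so the power of 2 divides the even
    one.\<close>
  hence "2 ^ r dvd t \<or> 2 ^ r dvd t + 1"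
  proof (cases "even t")
    case True
    hence "coprime (2 ^ r) (t + 1)" by simp
    with \<open>2 ^ r dvd t * (t + 1)\<close> show ?thesis by (simp add: coprime_dvd_mult_left_iff)
  next
    case False
    hence "coprime (2 ^ r) t" by simp
    with \<open>2 ^ r dvd t * (t + 1)\<close> show ?thesis by (simp add: coprime_dvd_mult_right_iff)
  qed
  thus ?thesis
  proof
    assume "2 ^ r dvd t"
    hence "2 ^ m dvd a - 1" by (simp add: r t)
    thus ?thesis by (simp add: cong_pm1_def cong_iff_dvd_diff)
  next
    assume "2 ^ r dvd t + 1"
    hence "2 * 2 ^ r dvd 2 * (t + 1)" by (rule mult_dvd_mono[OF dvd_refl])
    hence "2 ^ m dvd a - (- 1)" by (simp add: r t add.commute)
    thus ?thesis by (simp add: cong_pm1_def cong_iff_dvd_diff)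
  qed
qed

subsection \<open>Characters of groups with an elementary abelian quotient\<close>

text \<open>Image under \<chi> of the group ring identity ST = \<lambda>(G - e). The constant 1 is
  allowed for \<chi> and yields the count of S \<times> T.\<close>

lemma near_factorization_character_sum:
  fixes \<chi> :: "'a \<Rightarrow> complex"
  assumes "group G" and fin: "finite (carrier G)" and nf: "near_factorization G lam S T"
    and mult: "\<And>x y. x \<in> carrier G \<Longrightarrow> y \<in> carrier G \<Longrightarrow> \<chi> (x \<otimes>\<^bsub>G\<^esub> y) = \<chi> x * \<chi> y"
    and one: "\<chi> \<one>\<^bsub>G\<^esub> = 1"
  shows "sum \<chi> S * sum \<chi> T = of_nat lam * (sum \<chi> (carrier G) - 1)"
proof -
  interpret group G by fact
  have S: "S \<subseteq> carrier G" and T: "T \<subseteq> carrier G"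
    using nf by (auto simp: near_factorization_def)
  hence finST: "finite (S \<times> T)" using fin finite_subset by blast
  define R where "R g = {z \<in> S \<times> T. fst z \<otimes>\<^bsub>G\<^esub> snd z = g}" for g
  have R: "R g = {(x, y). x \<in> S \<and> y \<in> T \<and> x \<otimes>\<^bsub>G\<^esub> y = g}" for g
    by (auto simp: R_def)
  have "sum \<chi> S * sum \<chi> T = (\<Sum>z\<in>S \<times> T. \<chi> (fst z \<otimes>\<^bsub>G\<^esub> snd z))"
    unfolding sum_product sum.cartesian_product
    using S T by (intro sum.cong) (auto simp: subset_iff mult)
  also have "\<dots> = (\<Sum>g\<in>carrier G. \<Sum>z\<in>R g. \<chi> (fst z \<otimes>\<^bsub>G\<^esub> snd z))"
    unfolding R_def using S T fin finST by (intro sum.group[symmetric]) (auto simp: subset_iff)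
  also have "\<dots> = (\<Sum>g\<in>carrier G. \<Sum>z\<in>R g. \<chi> g)"
    by (intro sum.cong) (auto simp: R_def)
  also have "\<dots> = (\<Sum>g\<in>carrier G. of_nat (card (R g)) * \<chi> g)" by simp
  also have "\<dots> = of_nat (card (R \<one>\<^bsub>G\<^esub>)) * \<chi> \<one>\<^bsub>G\<^esub> +
      (\<Sum>g\<in>carrier G - {\<one>\<^bsub>G\<^esub>}. of_nat (card (R g)) * \<chi> g)"
    using fin by (intro sum.remove) auto
  also have "R \<one>\<^bsub>G\<^esub> = {}" using nf by (auto simp: R_def near_factorization_def)
  also have "(\<Sum>g\<in>carrier G - {\<one>\<^bsub>G\<^esub>}. of_nat (card (R g)) * \<chi> g) =
      (\<Sum>g\<in>carrier G - {\<one>\<^bsub>G\<^esub>}. of_nat lam * \<chi> g)"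
    using nf by (intro sum.cong refl) (simp add: R near_factorization_def)
  also have "\<dots> = of_nat lam * (sum \<chi> (carrier G) - 1)"
    using fin by (simp add: one sum_diff1 flip: sum_distrib_left)
  finally show ?thesis by simp
qed

text \<open>Left translation by \<open>h\<close> permutes the group and multiplies the sum by
  \<open>\<chi> h\<close>.\<close>

lemma sum_nontrivial_character:
  fixes \<chi> :: "'a \<Rightarrow> complex"
  assumes "group G"
    and mult: "\<And>x y. x \<in> carrier G \<Longrightarrow> y \<in> carrier G \<Longrightarrow> \<chi> (x \<otimes>\<^bsub>G\<^esub> y) = \<chi> x * \<chi> y"
    and h: "h \<in> carrier G" "\<chi> h \<noteq> 1"
  shows "sum \<chi> (carrier G) = 0"
proof -
  interpret group G by fact
  have "sum \<chi> (carrier G) = (\<Sum>g\<in>carrier G. \<chi> (h \<otimes>\<^bsub>G\<^esub> g))"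
    using h by (intro sum.reindex_bij_witness[of _ "\<lambda>x. h \<otimes>\<^bsub>G\<^esub> x" "\<lambda>x. inv\<^bsub>G\<^esub> h \<otimes>\<^bsub>G\<^esub> x"])
      (auto simp flip: m_assoc)
  also have "\<dots> = \<chi> h * sum \<chi> (carrier G)"
    using h by (simp add: mult sum_distrib_left)
  finally show ?thesis using h by simp
qed

text \<open>Replaces the quotient by integer coordinates on \<open>G\<close> itself, so that
  characters can be evaluated without cosets. Reaching the unit vectors suffices later to show that
  a character is nontrivial.\<close>

lemma elementary_abelian_quotient_coordinates:
  assumes "N \<lhd> G" and "(G Mod N) \<cong> elementary_abelian p m" and "p > 1"
  obtains \<phi> :: "'a \<Rightarrow> nat \<Rightarrow> int" where
    "\<forall>x\<in>carrier G. \<forall>y\<in>carrier G. \<forall>i<m. [\<phi> (x \<otimes>\<^bsub>G\<^esub> y) i = \<phi> x i + \<phi> y i] (mod int p)"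
    and "\<forall>i<m. \<exists>h\<in>carrier G. \<forall>j<m. \<phi> h j = of_bool (j = i)"
proof -
  interpret normal N G by fact
  obtain f where f: "f \<in> iso (G Mod N) (elementary_abelian p m)"
    using assms(2) by (auto simp: is_iso_def)
  define \<phi> where "\<phi> x = f (N #>\<^bsub>G\<^esub> x)" for x
  have "f \<in> hom (G Mod N) (elementary_abelian p m)" using f by (simp add: iso_def)
  with r_coset_hom_Mod have "f \<circ> (\<lambda>a. N #>\<^bsub>G\<^esub> a) \<in> hom G (elementary_abelian p m)"
    by (rule Group.hom_compose)
  hence hom: "\<phi> (x \<otimes>\<^bsub>G\<^esub> y) = \<phi> x \<otimes>\<^bsub>elementary_abelian p m\<^esub> \<phi> y"
    if "x \<in> carrier G" "y \<in> carrier G" for x y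
    using that by (auto simp: hom_def \<phi>_def)
  show ?thesis
  proof (rule that; intro ballI allI impI)
    fix x y i assume "x \<in> carrier G" "y \<in> carrier G" "i < m"
    thus "[\<phi> (x \<otimes>\<^bsub>G\<^esub> y) i = \<phi> x i + \<phi> y i] (mod int p)"
      by (simp add: hom elementary_abelian_def cong_def)
  next
    fix i assume "i < m"
    \<comment> \<open>The entries 0 and 1 are reduced residues because \<open>p > 1\<close>.\<close>
    have "(\<lambda>j\<in>{..<m}. of_bool (j = i)) \<in> carrier (elementary_abelian p m)"
      using \<open>p > 1\<close> by (auto simp: elementary_abelian_def carrier_integer_mod_group)
    also have "carrier (elementary_abelian p m) = f ` carrier (G Mod N)"
      using f by (auto simp: iso_def bij_betw_def)
    finally obtain c where c: "c \<in> carrier (G Mod N)" "f c = (\<lambda>j\<in>{..<m}. of_bool (j = i))"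
      by (metis imageE)
    then obtain h where h: "h \<in> carrier G" "c = N #>\<^bsub>G\<^esub> h"
      by (auto simp: FactGroup_def RCOSETS_def)
    from c h have "\<forall>j<m. \<phi> h j = of_bool (j = i)" by (simp add: \<phi>_def)
    with h show "\<exists>h\<in>carrier G. \<forall>j<m. \<phi> h j = of_bool (j = i)" by blast
  qed
qed

subsection \<open>Fourier inversion over the dual group\<close>

text \<open>The trivial character. It is written as a restricted function because members of
  \<open>dual\<close> are \<open>undefined\<close> outside \<open>{..<m}\<close>.\<close>

lemma zero_in_dual: "p > 0 \<Longrightarrow> (\<lambda>i\<in>{..<m}. 0) \<in> dual p m"
  by (simp add: PiE_iff)

text \<open>All entries lie below \<open>p\<close>, so a nonzero entry is not divisible by
  \<open>p\<close>.\<close>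

lemma dual_nonzeroE:
  assumes "u \<in> dual p m - {\<lambda>i\<in>{..<m}. 0}"
  obtains i where "i < m" "\<not> p dvd u i"
proof -
  have u: "u \<in> dual p m" using assms by (rule DiffD1)
  have "\<exists>i<m. \<not> p dvd u i"
  proof (rule ccontr)
    assume *: "\<not> (\<exists>i<m. \<not> p dvd u i)"
    have "u = (\<lambda>i\<in>{..<m}. 0)"
    proof (rule extensionalityI)
      show "u \<in> extensional {..<m}" using u by (simp add: PiE_iff)
      fix i assume "i \<in> {..<m}"
      with u * have "p dvd u i" "u i < p" by (auto simp: PiE_iff)
      hence "u i = 0" by (auto dest: dvd_imp_le)
      with \<open>i \<in> {..<m}\<close> show "u i = (\<lambda>i\<in>{..<m}. 0) i" by simp
    qed simp
    with assms show False by simp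
  qed
  thus ?thesis using that by blast
qed

lemma sum_dual_split:
  fixes f :: "(nat \<Rightarrow> nat) \<Rightarrow> int"
  assumes "p > 0"
  shows "sum f (dual p m) = f (\<lambda>i\<in>{..<m}. 0) + sum f (dual p m - {\<lambda>i\<in>{..<m}. 0})"
  using assms by (intro sum.remove zero_in_dual finite_PiE) auto

lemma card_dual_nonzero:
  assumes "p > 0"
  shows "int (card (dual p m - {\<lambda>i\<in>{..<m}. 0})) = int (p ^ m) - 1"
  using sum_dual_split[OF assms, of "\<lambda>_. 1" m] by (simp add: card_PiE)

text \<open>Fourier inversion as a counting device: orthogonality keeps only vectors that vanish
  modulo \<open>p\<close>, each with weight \<open>p ^ m\<close>.\<close>

lemma sum_dual_filter:
  assumes "p > 0" "finite Y"
  shows "(\<Sum>y\<in>Y. \<Sum>u\<in>dual p m. e_char p (dot m u (v y))) =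
    of_nat (p ^ m * card {y\<in>Y. \<forall>i<m. int p dvd v y i})"
proof -
  have "(\<Sum>y\<in>Y. \<Sum>u\<in>dual p m. e_char p (dot m u (v y))) =
      (\<Sum>y\<in>Y. if \<forall>i<m. int p dvd v y i then of_nat (p ^ m) else 0)"
    using assms by (simp only: sum_dual_e_char)
  also have "\<dots> = (\<Sum>y\<in>{y\<in>Y. \<forall>i<m. int p dvd v y i}. of_nat (p ^ m))"
    using assms by (intro sum.inter_filter[symmetric])
  finally show ?thesis by (simp add: mult.commute)
qed

text \<open>Expanding a norm gives one character value per tuple, taken at the weighted coordinate
  sum of the tuple; \<open>K\<close> counts the tuples for which this sum is zero modulo
  \<open>p\<close>.\<close>

lemma sum_dual_norms:
  fixes \<phi> :: "'a \<Rightarrow> nat \<Rightarrow> int"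
  assumes "p > 0" "finite S"
  obtains K :: nat where
    "(\<Sum>u\<in>dual p m. \<Prod>k\<in>{1..<p}. \<Sum>x\<in>S. e_char p (int k * dot m u (\<phi> x))) = of_nat (p ^ m * K)"
proof -
  define v where "v y i = (\<Sum>k\<in>{1..<p}. int k * \<phi> (y k) i)" for y i
  have dot: "(\<Sum>k\<in>{1..<p}. int k * dot m u (\<phi> (y k))) = dot m u (v y)" for u y
    unfolding v_def sum_distrib_left by (subst sum.swap) (simp only: mult.left_commute)
  have "(\<Sum>u\<in>dual p m. \<Prod>k\<in>{1..<p}. \<Sum>x\<in>S. e_char p (int k * dot m u (\<phi> x))) =
      (\<Sum>u\<in>dual p m. \<Sum>y\<in>{1..<p} \<rightarrow>\<^sub>E S. e_char p (dot m u (v y)))"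
    using \<open>finite S\<close> by (simp only: prod_sum_PiE finite_atLeastLessThan dot flip: e_char_sum)
  also have "\<dots> = (\<Sum>y\<in>{1..<p} \<rightarrow>\<^sub>E S. \<Sum>u\<in>dual p m. e_char p (dot m u (v y)))"
    by (rule sum.swap)
  also have "\<dots> = of_nat (p ^ m * card {y\<in>{1..<p} \<rightarrow>\<^sub>E S. \<forall>i<m. int p dvd v y i})"
    using assms by (intro sum_dual_filter finite_PiE) auto
  finally show ?thesis by (rule that)
qed

section \<open>Norms of the character sums and the size of S\<close>

text \<open>The norms for \<open>S\<close> and \<open>T\<close> multiply to
  \<open>(- lam) ^ (p - 1)\<close>, so the first divides a power of \<open>lam\<close>. The
  hypothesis \<open>chi\<close> ranges over unreduced \<open>u\<close> as well, which makes it
  applicable to the multiples of \<open>u\<close> by \<open>k\<close>.\<close>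

lemma norm_cong_pm1:
  fixes \<phi> :: "'a \<Rightarrow> nat \<Rightarrow> int"
  assumes p: "Factorial_Ring.prime p" and fin: "finite S" "finite T"
    and lam: "lam > 0" "\<forall>l::nat. Factorial_Ring.prime l \<and> l dvd lam \<longrightarrow> cong_pm1 (int l) (int q)"
    and chi: "\<forall>u i. i < m \<and> \<not> p dvd u i \<longrightarrow>
      (\<Sum>x\<in>S. e_char p (dot m u (\<phi> x))) * (\<Sum>x\<in>T. e_char p (dot m u (\<phi> x))) = - of_nat lam"
    and u: "i < m" "\<not> p dvd u i"
  obtains n :: int where "(\<Prod>k\<in>{1..<p}. \<Sum>x\<in>S. e_char p (int k * dot m u (\<phi> x))) = of_int n"
    and "[n = int (card S) ^ (p - 1)] (mod int p)" and "cong_pm1 n (int q)"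
proof -
  obtain n where n: "(\<Prod>k\<in>{1..<p}. \<Sum>x\<in>S. e_char p (int k * dot m u (\<phi> x))) = of_int n"
      "[n = int (card S) ^ (p - 1)] (mod int p)"
    by (rule cyclotomic_norm[OF p fin(1)])
  obtain n' where n': "(\<Prod>k\<in>{1..<p}. \<Sum>x\<in>T. e_char p (int k * dot m u (\<phi> x))) = of_int n'"
    by (rule cyclotomic_norm[OF p fin(2)])
  have "of_int (n * n') = (\<Prod>k\<in>{1..<p}. - complex_of_nat lam)"
    unfolding of_int_mult n(1)[symmetric] n'[symmetric] prod.distrib[symmetric]
  proof (rule prod.cong[OF refl])
    fix k assume "k \<in> {1..<p}"
    hence "\<not> p dvd k" by (auto dest: dvd_imp_le)
    \<comment> \<open>The k-th power of the character is again nontrivial, as \<open>p\<close> is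
      prime.\<close>
    hence "\<not> p dvd k * u i" using u p by (simp add: prime_dvd_mult_iff)
    moreover have "int k * dot m u v = dot m (\<lambda>i. k * u i) v" for v
      by (simp add: sum_distrib_left mult.assoc)
    ultimately show "(\<Sum>x\<in>S. e_char p (int k * dot m u (\<phi> x))) *
        (\<Sum>x\<in>T. e_char p (int k * dot m u (\<phi> x))) = - of_nat lam"
      using chi[rule_format, of i "\<lambda>i. k * u i"] \<open>i < m\<close> by (simp only: simp_thms)
  qed
  also have "\<dots> = of_int ((- int lam) ^ (p - 1))" by simp
  finally have "n * n' = (- int lam) ^ (p - 1)" by (simp only: of_int_eq_iff)
  hence "n dvd (- int lam) ^ (p - 1)" by (metis dvd_triv_left)
  \<comment> \<open>The extra factor merges with the power and removes its sign.\<close>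
  hence "n dvd (- 1) ^ (p - 1) * (- int lam) ^ (p - 1)" by (rule dvd_mult)
  hence "n dvd int lam ^ (p - 1)" by (simp flip: power_mult_distrib)
  hence "cong_pm1 n (int q)" using lam by (intro cong_pm1_of_dvd_power)
  with n show ?thesis by (rule that)
qed

text \<open>Modulo \<open>p ^ m\<close> all norms together sum to 0, and each of the
  \<open>p ^ m - 1\<close> nontrivial ones contributes 1.\<close>

lemma card_power_cong_1:
  fixes \<phi> :: "'a \<Rightarrow> nat \<Rightarrow> int"
  assumes p: "Factorial_Ring.prime p" and "odd p" and "m \<ge> 1" and fin: "finite S" "finite T"
    and lam: "lam > 0" "\<forall>l::nat. Factorial_Ring.prime l \<and> l dvd lam \<longrightarrow> cong_pm1 (int l) (int (p ^ m))"
    and chi: "\<forall>u i. i < m \<and> \<not> p dvd u i \<longrightarrow>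
      (\<Sum>x\<in>S. e_char p (dot m u (\<phi> x))) * (\<Sum>x\<in>T. e_char p (dot m u (\<phi> x))) = - of_nat lam"
  shows "[card S ^ (p - 1) = 1] (mod p ^ m)"
proof -
  define Z where "Z = (\<lambda>i\<in>{..<m}. 0 :: nat)"
  define P where "P u = (\<Prod>k\<in>{1..<p}. \<Sum>x\<in>S. e_char p (int k * dot m u (\<phi> x)))" for u
  have p0: "p > 0" using p by (rule prime_gt_0_nat)
  have p_dvd: "int p dvd int (p ^ m)" using \<open>m \<ge> 1\<close> by (simp add: dvd_power)
  have ex: "\<exists>n::int. P u = of_int n \<and> [n = 1] (mod int (p ^ m))" if nz: "u \<in> dual p m - {Z}" for u
  proof -
    from nz obtain i where "i < m" "\<not> p dvd u i" unfolding Z_def by (rule dual_nonzeroE)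
    then obtain n where n: "P u = of_int n" "[n = int (card S) ^ (p - 1)] (mod int p)"
        and pm1: "cong_pm1 n (int (p ^ m))"
      unfolding P_def by (rule norm_cong_pm1[OF p fin lam chi])
    have n_p: "[n = 1] (mod int p) \<or> [n = - 1] (mod int p)"
      using pm1 p_dvd unfolding cong_pm1_def by (meson cong_dvd_modulus)
    \<comment> \<open>Otherwise \<open>p\<close> would divide the norm, which is \<plusminus>1
      modulo \<open>p\<close>.\<close>
    have "\<not> p dvd card S"
    proof
      assume "p dvd card S"
      hence "p dvd card S ^ (p - 1)"
        using prime_gt_1_nat[OF p] by (intro dvd_trans[OF _ dvd_power]) auto
      hence "int p dvd int (card S) ^ (p - 1)"
        by (simp flip: of_nat_power)
      hence "int p dvd n" using n(2) by (simp add: cong_dvd_iff)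
      hence "int p dvd 1" using n_p by (auto simp: cong_dvd_iff)
      thus False using prime_gt_1_nat[OF p] by simp
    qed
    hence "[card S ^ (p - 1) = 1] (mod p)" using p by (intro fermat_theorem)
    hence "[int (card S) ^ (p - 1) = 1] (mod int p)" by (metis cong_int_iff of_nat_1 of_nat_power)
    with n(2) have n_1: "[n = 1] (mod int p)" by (rule cong_trans)
    \<comment> \<open>For odd \<open>p\<close> the signs are distinct modulo \<open>p\<close>, so
      the residue there decides the sign modulo \<open>p ^ m\<close>.\<close>
    have "\<not> [n = - 1] (mod int (p ^ m))"
    proof
      assume "[n = - 1] (mod int (p ^ m))"
      hence "[n = - 1] (mod int p)" using p_dvd by (rule cong_dvd_modulus)
      with n_1 have "[1 = - 1] (mod int p)" by (metis cong_sym cong_trans)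
      hence "int p dvd 2" by (simp add: cong_iff_dvd_diff)
      hence "p dvd 2" by (metis int_dvd_int_iff of_nat_numeral)
      hence "p = 2" using p by (simp add: primes_dvd_imp_eq)
      with \<open>odd p\<close> show False by simp
    qed
    with pm1 n(1) show ?thesis by (auto simp: cong_pm1_def)
  qed
  \<comment> \<open>The fact \<open>ex\<close> says nothing about the trivial character, whose norm
    is therefore entered directly.\<close>
  define n where "n u = (if u = Z then int (card S) ^ (p - 1) else (SOME n. P u = of_int n \<and> [n = 1] (mod int (p ^ m))))" for u
  have n1: "P u = of_int (n u) \<and> [n u = 1] (mod int (p ^ m))" if "u \<in> dual p m - {Z}" for u
    using someI_ex[OF ex[OF that]] that by (auto simp: n_def)
  have "P Z = of_int (n Z)" by (simp add: n_def P_def Z_def)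
  with n1 have P_n: "P u = of_int (n u)" if "u \<in> dual p m" for u
    using that by (cases "u = Z") auto
  obtain K where "(\<Sum>u\<in>dual p m. P u) = of_nat (p ^ m * K)"
    unfolding P_def by (rule sum_dual_norms[OF p0 fin(1)])
  hence "(of_int (\<Sum>u\<in>dual p m. n u) :: complex) = of_int (int (p ^ m) * int K)"
    by (simp add: P_n)
  hence K: "(\<Sum>u\<in>dual p m. n u) = int (p ^ m) * int K"
    by (simp only: of_int_eq_iff)
  have "[(\<Sum>u\<in>dual p m. n u) = int (card S) ^ (p - 1) + (\<Sum>u\<in>dual p m - {Z}. 1)] (mod int (p ^ m))"
    unfolding sum_dual_split[OF p0] Z_def[symmetric] using n1
    by (intro cong_add cong_sum) (auto simp: n_def)
  also have "int (card S) ^ (p - 1) + (\<Sum>u\<in>dual p m - {Z}. 1) =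
      int (card S) ^ (p - 1) - 1 + int (p ^ m)"
    using card_dual_nonzero[OF p0, of m] by (simp add: Z_def)
  finally have "int (p ^ m) dvd int (card S) ^ (p - 1) - 1"
    unfolding K by (simp add: cong_iff_dvd_diff dvd_diff_right_iff dvd_diff_commute)
  hence "[int (card S ^ (p - 1)) = int 1] (mod int (p ^ m))"
    by (simp add: cong_iff_dvd_diff)
  thus ?thesis by (simp only: cong_int_iff)
qed

text \<open>For \<open>p = 2\<close> the signs of the norms remain unknown, so their squares are
  summed. Squaring gains a factor 2 in the modulus, and this is what allows \<plusminus>1 to be
  recovered from the square of |S|.\<close>

lemma card_cong_pm1:
  fixes \<phi> :: "'a \<Rightarrow> nat \<Rightarrow> int"
  assumes "m \<ge> 1" and fin: "finite S" "finite T"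
    and lam: "lam > 0" "\<forall>l::nat. Factorial_Ring.prime l \<and> l dvd lam \<longrightarrow> cong_pm1 (int l) (int (2 ^ m))"
    and chi: "\<forall>u i. i < m \<and> \<not> 2 dvd u i \<longrightarrow>
      (\<Sum>x\<in>S. e_char 2 (dot m u (\<phi> x))) * (\<Sum>x\<in>T. e_char 2 (dot m u (\<phi> x))) = - of_nat lam"
  shows "cong_pm1 (int (card S)) (2 ^ m)"
proof -
  define Z where "Z = (\<lambda>i\<in>{..<m}. 0 :: nat)"
  define P where "P u = (\<Sum>x\<in>S. e_char 2 (dot m u (\<phi> x)))" for u
  define s where "s = int (card S)"
  obtain r where r: "m = Suc r" using \<open>m \<ge> 1\<close> by (cases m) auto
  have ex: "\<exists>n::int. P u = of_int n \<and> [n\<^sup>2 = 1] (mod 2 * 2 ^ m)" if nz: "u \<in> dual 2 m - {Z}" for u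
  proof -
    from nz obtain i where "i < m" "\<not> 2 dvd u i" unfolding Z_def by (rule dual_nonzeroE)
    \<comment> \<open>The product over \<open>{1..<2}\<close> has one factor, so the norm is the
      character sum itself.\<close>
    then obtain n where n: "P u = of_int n" and pm1: "cong_pm1 n (int (2 ^ m))"
      by (rule norm_cong_pm1[OF two_is_prime_nat fin lam chi]) (simp add: P_def numeral_2_eq_2)
    from pm1 have "2 ^ m dvd n - 1 \<or> 2 ^ m dvd n + 1"
      by (simp add: cong_pm1_def cong_iff_dvd_diff)
    then obtain k where "n - 1 = 2 ^ m * k \<or> n + 1 = 2 ^ m * k"
      unfolding dvd_def by blast
    hence "n = 2 ^ m * k + 1 \<or> n = 2 ^ m * k - 1" by linarith
    \<comment> \<open>Since \<open>m = Suc r\<close>, the square of \<open>2 ^ m\<close> is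
      \<open>2 * 2 ^ m * 2 ^ r\<close>.\<close>
    hence "n\<^sup>2 - 1 = 2 * 2 ^ m * (k + 2 ^ r * k\<^sup>2) \<or> n\<^sup>2 - 1 = 2 * 2 ^ m * (- k + 2 ^ r * k\<^sup>2)"
    proof
      assume *: "n = 2 ^ m * k + 1"
      show ?thesis unfolding * by (rule disjI1) (simp add: r power2_eq_square algebra_simps)
    next
      assume *: "n = 2 ^ m * k - 1"
      show ?thesis unfolding * by (rule disjI2) (simp add: r power2_eq_square algebra_simps)
    qed
    hence "2 * 2 ^ m dvd n\<^sup>2 - 1" by (metis dvd_triv_left)
    with n show ?thesis by (auto simp: cong_iff_dvd_diff)
  qed
  define n where "n u = (if u = Z then s else (SOME n. P u = of_int n \<and> [n\<^sup>2 = 1] (mod 2 * 2 ^ m)))" for u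
  have n1: "P u = of_int (n u) \<and> [(n u)\<^sup>2 = 1] (mod 2 * 2 ^ m)" if "u \<in> dual 2 m - {Z}" for u
    using someI_ex[OF ex[OF that]] that by (auto simp: n_def)
  have "P Z = of_int (n Z)" by (simp add: n_def P_def Z_def s_def)
  with n1 have P_n: "P u = of_int (n u)" if "u \<in> dual 2 m" for u
    using that by (cases "u = Z") auto
  \<comment> \<open>Equality of images in the quotient, as signs do not matter modulo 2. It is
    reflexive and symmetric, so the number \<open>K\<close> of related pairs has the parity of
    |S|.\<close>
  define R where "R x y \<longleftrightarrow> (\<forall>i<m. 2 dvd \<phi> x i + \<phi> y i)" for x y
  define K where "K = card {z \<in> S \<times> S. R (fst z) (snd z)}"
  have "(\<Sum>u\<in>dual 2 m. (P u)\<^sup>2) = (\<Sum>u\<in>dual 2 m. \<Sum>z\<in>S \<times> S. e_char 2 (dot m u (\<lambda>i. \<phi> (fst z) i + \<phi> (snd z) i)))"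
    by (simp add: P_def power2_eq_square sum_product sum.cartesian_product case_prod_unfold
        distrib_left sum.distrib e_char_add)
  also have "\<dots> = (\<Sum>z\<in>S \<times> S. \<Sum>u\<in>dual 2 m. e_char 2 (dot m u (\<lambda>i. \<phi> (fst z) i + \<phi> (snd z) i)))"
    by (rule sum.swap)
  also have "\<dots> = of_nat (2 ^ m * K)"
    using fin sum_dual_filter[of 2 "S \<times> S" "\<lambda>z i. \<phi> (fst z) i + \<phi> (snd z) i" m]
    by (simp add: K_def R_def)
  finally have "(of_int (\<Sum>u\<in>dual 2 m. (n u)\<^sup>2) :: complex) = of_int (2 ^ m * int K)"
    by (simp add: P_n)
  hence sum_n: "(\<Sum>u\<in>dual 2 m. (n u)\<^sup>2) = 2 ^ m * int K"
    by (simp only: of_int_eq_iff)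
  have "K = card (SIGMA x:S. {y\<in>S. R x y})"
    unfolding K_def by (rule arg_cong[where f = card]) auto
  hence "int K = (\<Sum>x\<in>S. \<Sum>y\<in>S. of_bool (R x y))"
    using fin by (simp add: Int_def)
  also have "[\<dots> = (\<Sum>x\<in>S. of_bool (R x x))] (mod 2)"
    using fin by (intro cong_sum_symmetric_diagonal) (auto simp: R_def add.commute)
  also have "(\<Sum>x\<in>S. of_bool (R x x)) = s" by (simp add: R_def s_def)
  finally have K: "[int K = s] (mod 2)" .
  have "[(\<Sum>u\<in>dual 2 m. (n u)\<^sup>2) = s\<^sup>2 + (\<Sum>u\<in>dual 2 m - {Z}. 1)] (mod 2 * 2 ^ m)"
    unfolding sum_dual_split[OF pos2] Z_def[symmetric] using n1
    by (intro cong_add cong_sum) (auto simp: n_def)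
  also have "s\<^sup>2 + (\<Sum>u\<in>dual 2 m - {Z}. 1) = s\<^sup>2 - 1 + 2 ^ m"
    using card_dual_nonzero[OF pos2, of m] by (simp add: Z_def)
  finally have main: "2 * 2 ^ m dvd 2 ^ m * int K - (s\<^sup>2 - 1 + 2 ^ m)"
    unfolding sum_n by (simp add: cong_iff_dvd_diff)
  \<comment> \<open>Parity of \<open>main\<close> makes \<open>s\<close> odd, hence \<open>K\<close>
    odd. Then \<open>2 ^ m * K\<close> and \<open>2 ^ m\<close> agree modulo
    \<open>2 * 2 ^ m\<close> and cancel, leaving the square of \<open>s\<close> congruent to
    1.\<close>
  hence "even (2 ^ m * int K - (s\<^sup>2 - 1 + 2 ^ m))" by (meson dvd_trans dvd_triv_left)
  hence "odd s" using \<open>m \<ge> 1\<close> by simp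
  hence "odd (int K)" using K by (simp add: cong_iff_dvd_diff)
  hence "2 * 2 ^ m dvd 2 ^ m * (int K - 1)" by simp
  with main have "2 * 2 ^ m dvd 2 ^ m * (int K - 1) - (2 ^ m * int K - (s\<^sup>2 - 1 + 2 ^ m))"
    by (rule dvd_diff[rotated])
  hence "[s\<^sup>2 = 1] (mod 2 * 2 ^ m)" by (simp add: cong_iff_dvd_diff algebra_simps)
  thus ?thesis using \<open>m \<ge> 1\<close> unfolding s_def by (rule cong_pm1_of_square)
qed

subsection \<open>Near-factorizations\<close>

text \<open>The index of \<open>N\<close> is \<open>p ^ m\<close>. This makes |G| vanish in the
  counting identity modulo \<open>p ^ m\<close>.\<close>

lemma elementary_abelian_quotient_dvd_card:
  assumes "N \<lhd> G" and "(G Mod N) \<cong> elementary_abelian p m" and "p > 0"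
  shows "p ^ m dvd card (carrier G)"
proof -
  interpret normal N G by fact
  obtain f where "f \<in> iso (G Mod N) (elementary_abelian p m)"
    using assms(2) by (auto simp: is_iso_def)
  hence "card (carrier (G Mod N)) = card (carrier (elementary_abelian p m))"
    by (auto simp: iso_def dest: bij_betw_same_card)
  also have "\<dots> = p ^ m"
    using \<open>p > 0\<close> by (simp add: elementary_abelian_def carrier_integer_mod_group card_PiE)
  finally have "card (rcosets\<^bsub>G\<^esub> N) = p ^ m" by (simp add: FactGroup_def)
  thus ?thesis using lagrange[OF is_subgroup] by (metis dvd_triv_left order_def)
qed

text \<open>The trivial character in the character identity, read back in the integers.\<close>

lemma near_factorization_card:
  assumes "group G" "finite (carrier G)" "near_factorization G lam S T"
  shows "int (card S) * int (card T) = int lam * (int (card (carrier G)) - 1)"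
proof -
  have "(of_int (int (card S) * int (card T)) :: complex) = of_int (int lam * (int (card (carrier G)) - 1))"
    using near_factorization_character_sum[OF assms, of "\<lambda>_. 1"] by simp
  thus ?thesis by (simp only: of_int_eq_iff)
qed

text \<open>The character pulled back to \<open>G\<close> takes the value
  \<open>e_char p (u i)\<close>, different from 1, at a preimage of the i-th unit vector. Its sum
  over \<open>G\<close> is therefore 0 and only \<open>- lam\<close> survives.\<close>

lemma near_factorization_quotient_character:
  fixes \<phi> :: "'a \<Rightarrow> nat \<Rightarrow> int"
  assumes G: "group G" "finite (carrier G)" "near_factorization G lam S T" and "p > 0"
    and \<phi>: "\<forall>x\<in>carrier G. \<forall>y\<in>carrier G. \<forall>i<m. [\<phi> (x \<otimes>\<^bsub>G\<^esub> y) i = \<phi> x i + \<phi> y i] (mod int p)"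
    and surj: "\<forall>i<m. \<exists>h\<in>carrier G. \<forall>j<m. \<phi> h j = of_bool (j = i)"
    and u: "i < m" "\<not> p dvd u i"
  shows "(\<Sum>x\<in>S. e_char p (dot m u (\<phi> x))) * (\<Sum>x\<in>T. e_char p (dot m u (\<phi> x))) = - of_nat lam"
proof -
  interpret group G by fact
  define \<chi> where "\<chi> x = e_char p (dot m u (\<phi> x))" for x
  have mult: "\<chi> (x \<otimes>\<^bsub>G\<^esub> y) = \<chi> x * \<chi> y" if "x \<in> carrier G" "y \<in> carrier G" for x y
  proof -
    have "[dot m u (\<phi> (x \<otimes>\<^bsub>G\<^esub> y)) = (\<Sum>i<m. int (u i) * (\<phi> x i + \<phi> y i))] (mod int p)"
      using that by (intro cong_sum cong_scalar_left \<phi>[rule_format]) auto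
    also have "(\<Sum>i<m. int (u i) * (\<phi> x i + \<phi> y i)) = dot m u (\<phi> x) + dot m u (\<phi> y)"
      by (simp add: distrib_left sum.distrib)
    finally show ?thesis
      using e_char_cong[OF \<open>p > 0\<close>] by (simp only: \<chi>_def flip: e_char_add)
  qed
  have "\<chi> \<one>\<^bsub>G\<^esub> = \<chi> \<one>\<^bsub>G\<^esub> * \<chi> \<one>\<^bsub>G\<^esub>" using mult[of "\<one>\<^bsub>G\<^esub>" "\<one>\<^bsub>G\<^esub>"] by simp
  moreover have "\<chi> \<one>\<^bsub>G\<^esub> \<noteq> 0" by (simp add: \<chi>_def e_char_def)
  ultimately have one: "\<chi> \<one>\<^bsub>G\<^esub> = 1" by simp
  obtain h where h: "h \<in> carrier G" "\<forall>j<m. \<phi> h j = of_bool (j = i)"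
    using surj \<open>i < m\<close> by blast
  have "dot m u (\<phi> h) = (\<Sum>j<m. if j = i then int (u i) else 0)"
    using h(2) by (intro sum.cong) auto
  also have "\<dots> = int (u i)" using \<open>i < m\<close> by simp
  finally have "\<chi> h \<noteq> 1"
    using u \<open>p > 0\<close> by (simp add: \<chi>_def e_char_eq_1_iff)
  hence "sum \<chi> (carrier G) = 0"
    using G(1) mult h(1) by (intro sum_nontrivial_character)
  thus ?thesis
    using near_factorization_character_sum[OF G mult one] by (simp add: \<chi>_def)
qed

text \<open>Serves to exchange \<open>lam ^ (q - 1)\<close> for \<open>lam\<close>, as
  \<open>q - 1\<close> is odd when \<open>p = 2\<close>.\<close>

lemma cong_pm1_power_odd:
  assumes "cong_pm1 a q" "odd k"
  shows "[a ^ k = a] (mod q)"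
proof -
  obtain s where s: "s = 1 \<or> s = - 1" "[a = s] (mod q)"
    using assms(1) unfolding cong_pm1_def by blast
  have "[a ^ k = s ^ k] (mod q)" using s(2) by (rule cong_pow)
  also have "s ^ k = s" using s(1) \<open>odd k\<close> by auto
  also have "[s = a] (mod q)" using s(2) by (rule cong_sym)
  finally show ?thesis .
qed

text \<open>A residue \<plusminus>1 is its own inverse.\<close>

lemma cong_pm1_cofactor:
  assumes "cong_pm1 s q" "[s * t = c] (mod q)"
  shows "[t = c * s] (mod q)"
proof -
  obtain \<epsilon> where \<epsilon>: "\<epsilon> = 1 \<or> \<epsilon> = - 1" "[s = \<epsilon>] (mod q)"
    using assms(1) unfolding cong_pm1_def by blast
  hence "[s * s = \<epsilon> * \<epsilon>] (mod q)" by (intro cong_mult)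
  also have "\<epsilon> * \<epsilon> = 1" using \<epsilon>(1) by auto
  finally have "[s * s * t = 1 * t] (mod q)" by (rule cong_scalar_right)
  moreover have "[(s * t) * s = c * s] (mod q)" using assms(2) by (rule cong_scalar_right)
  ultimately show ?thesis by (simp add: cong_def mult_ac)
qed

theorem theorem3p2:
  fixes G :: "('a, 'b) monoid_scheme" and N S T :: "'a set" and p m q lam :: nat
  assumes "Factorial_Ring.prime p" and "m \<ge> 1" and "q = p ^ m"
    and "lam > 0"
    and "\<forall>l::nat. Factorial_Ring.prime l \<and> l dvd lam \<longrightarrow> cong_pm1 (int l) (int q)"
    and "group G" and "finite (carrier G)"
    and "N \<lhd> G" and "(G Mod N) \<cong> elementary_abelian p m"
    and "near_factorization G lam S T"
  shows "(odd p \<longrightarrow>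
            [card S ^ (p - 1) = card T ^ (p - 1)] (mod p ^ m) \<and>
            [card T ^ (p - 1) = 1] (mod p ^ m)) \<and>
         (p = 2 \<and> [int lam ^ (q - 1) = 1] (mod int q) \<longrightarrow>
            [int (card S) = - int (card T)] (mod 2 ^ m) \<and>
            cong_pm1 (int (card S)) (2 ^ m)) \<and>
         (p = 2 \<and> [int lam ^ (q - 1) = - 1] (mod int q) \<longrightarrow>
            [int (card S) = int (card T)] (mod 2 ^ m) \<and>
            cong_pm1 (int (card S)) (2 ^ m))"
proof -
  note prime = assms(1) and nf = assms(6,7,10)
  have p1: "p > 1" and p0: "p > 0" using prime prime_gt_1_nat prime_gt_0_nat by auto
  have lam: "lam > 0" "\<forall>l::nat. Factorial_Ring.prime l \<and> l dvd lam \<longrightarrow> cong_pm1 (int l) (int (p ^ m))"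
    using assms(3-5) by auto
  have fin: "finite S" "finite T"
    using nf finite_subset by (auto simp: near_factorization_def)
  obtain \<phi> :: "'a \<Rightarrow> nat \<Rightarrow> int" where
    \<phi>: "\<forall>x\<in>carrier G. \<forall>y\<in>carrier G. \<forall>i<m. [\<phi> (x \<otimes>\<^bsub>G\<^esub> y) i = \<phi> x i + \<phi> y i] (mod int p)"
    and surj: "\<forall>i<m. \<exists>h\<in>carrier G. \<forall>j<m. \<phi> h j = of_bool (j = i)"
    by (rule elementary_abelian_quotient_coordinates[OF assms(8,9) p1])
  have chi: "\<forall>u i. i < m \<and> \<not> p dvd u i \<longrightarrow>
      (\<Sum>x\<in>S. e_char p (dot m u (\<phi> x))) * (\<Sum>x\<in>T. e_char p (dot m u (\<phi> x))) = - of_nat lam"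
    using near_factorization_quotient_character[OF nf p0 \<phi> surj] by blast
  \<comment> \<open>Complex numbers commute, so \<open>S\<close> and \<open>T\<close> may be
    exchanged even when \<open>G\<close> is not abelian.\<close>
  hence chi': "\<forall>u i. i < m \<and> \<not> p dvd u i \<longrightarrow>
      (\<Sum>x\<in>T. e_char p (dot m u (\<phi> x))) * (\<Sum>x\<in>S. e_char p (dot m u (\<phi> x))) = - of_nat lam"
    by (simp only: mult.commute)
  have odd_case: "[card S ^ (p - 1) = card T ^ (p - 1)] (mod p ^ m) \<and> [card T ^ (p - 1) = 1] (mod p ^ m)"
    if "odd p"
  proof -
    have "[card S ^ (p - 1) = 1] (mod p ^ m)"
      by (rule card_power_cong_1[OF prime that \<open>m \<ge> 1\<close> fin lam chi])
    moreover have T: "[card T ^ (p - 1) = 1] (mod p ^ m)"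
      by (rule card_power_cong_1[OF prime that \<open>m \<ge> 1\<close> fin(2,1) lam chi'])
    ultimately show ?thesis by (metis cong_sym cong_trans)
  qed
  \<comment> \<open>Treats both signs of \<open>lam ^ (q - 1)\<close> at once; the two cases below
    only substitute its value.\<close>
  have even_case: "[int (card T) = - (int lam ^ (q - 1)) * int (card S)] (mod 2 ^ m) \<and> cong_pm1 (int (card S)) (2 ^ m)"
    if "p = 2"
  proof -
    have S: "cong_pm1 (int (card S)) (2 ^ m)"
      using \<open>m \<ge> 1\<close> fin lam chi unfolding that by (rule card_cong_pm1)
    have "cong_pm1 (int lam) (2 ^ m)"
      using cong_pm1_of_prime_divisors[OF lam(2,1)] by (simp add: that)
    moreover have "odd (q - 1)" using \<open>m \<ge> 1\<close> by (simp add: assms(3) that)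
    ultimately have lam_pow: "[int lam ^ (q - 1) = int lam] (mod 2 ^ m)"
      by (rule cong_pm1_power_odd)
    have "2 ^ m dvd int (card (carrier G))"
      using elementary_abelian_quotient_dvd_card[OF assms(8,9) p0]
      by (metis int_dvd_int_iff of_nat_numeral of_nat_power that)
    hence "[int (card (carrier G)) = 0] (mod 2 ^ m)" by (simp add: cong_0_iff)
    \<comment> \<open>With |G| congruent to 0, the product |S| |T| becomes \<open>- lam\<close>,
      rewritten as \<open>- (lam ^ (q - 1))\<close> to match the case distinction.\<close>
    hence "[int lam * (int (card (carrier G)) - 1) = int lam ^ (q - 1) * (0 - 1)] (mod 2 ^ m)"
      using lam_pow by (intro cong_mult cong_diff cong_refl) (rule cong_sym)
    hence "[int (card S) * int (card T) = - (int lam ^ (q - 1))] (mod 2 ^ m)"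
      by (simp add: near_factorization_card[OF nf])
    with S show ?thesis by (blast intro: cong_pm1_cofactor)
  qed
  have plus: "[int (card S) = - int (card T)] (mod 2 ^ m) \<and> cong_pm1 (int (card S)) (2 ^ m)"
    if "p = 2" "[int lam ^ (q - 1) = 1] (mod int q)"
  proof -
    have "[- (int lam ^ (q - 1)) * int (card S) = - 1 * int (card S)] (mod 2 ^ m)"
      using that assms(3) by (intro cong_scalar_right) (simp add: cong_minus_minus_iff)
    with even_case[OF that(1)] have "[int (card T) = - int (card S)] (mod 2 ^ m)"
      by (auto intro: cong_trans)
    hence "[- int (card T) = int (card S)] (mod 2 ^ m)"
      using cong_minus_minus_iff[of "int (card T)" "- int (card S)" "2 ^ m"] by simp
    with even_case[OF that(1)] show ?thesis by (auto intro: cong_sym)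
  qed
  have minus: "[int (card S) = int (card T)] (mod 2 ^ m) \<and> cong_pm1 (int (card S)) (2 ^ m)"
    if "p = 2" "[int lam ^ (q - 1) = - 1] (mod int q)"
  proof -
    have "[- (int lam ^ (q - 1)) * int (card S) = - (- 1) * int (card S)] (mod 2 ^ m)"
      using that assms(3) by (intro cong_scalar_right) (simp only: cong_minus_minus_iff of_nat_power of_nat_numeral)
    with even_case[OF that(1)] have "[int (card T) = int (card S)] (mod 2 ^ m)"
      by (auto intro: cong_trans)
    with even_case[OF that(1)] show ?thesis by (auto intro: cong_sym)
  qed
  show ?thesis using odd_case plus minus by blast
qed

end
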